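(* Let $A$ be a finite alphabet, let $n\leq m$, and let $u\in A^n$, $v\in A^m$ be palindromes. Then $C_{u,v} = C_{v,u}[m-n,\ldots,m-1]$; that is, $C_{u,v}[k]=C_{v,u}[m-n+k]$ for every $k\in\{0,1,\ldots,n-1\}$.
   Context: Words are indexed from $0$: $u=u[0]\cdots u[n-1]$, and $w[a,\ldots,b]$ denotes the factor $w[a]\cdots w[b]$. A palindrome is a word equal to its reversal. Write $[n]=\{0,\ldots,n-1\}$. For $u\in A^n$, $v\in A^m$, the correlation of $u$ over $v$ is the binary word $C_{u,v}$ of length $n$ such that for $k\in[n]$, $C_{u,v}[k]=1$ if $u[i]=v[j]$ for all $i\in[n]$, $j\in[m]$ with $i=j+k$, and $C_{u,v}[k]=0$ otherwise. *)

theory Defs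
  imports Main
begin

definition words :: "'a set \<Rightarrow> nat \<Rightarrow> 'a list set" where
  "words A n = {w. set w \<subseteq> A \<and> length w = n}"

definition palindrome :: "'a list \<Rightarrow> bool" where
  "palindrome w \<longleftrightarrow> rev w = w"

text \<open>Both end positions are included. Subtraction being truncated, the last position
  \<open>length w - 1\<close> of the empty word is \<open>0\<close>; with \<open>take\<close> and \<open>drop\<close> the factor up to it is
  still the empty word.\<close>

definition factor :: "'a list \<Rightarrow> nat \<Rightarrow> nat \<Rightarrow> 'a list" where
  "factor w a b = take (Suc b - a) (drop a w)"

definition correlation :: "'a list \<Rightarrow> 'a list \<Rightarrow> nat list" where
  "correlation u v =
     map (\<lambda>k. if \<forall>i\<in>{..<length u}. \<forall>j\<in>{..<length v}. i = j + k \<longrightarrow> u ! i = v ! j then 1 else 0)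
       [0..<length u]"

end

theory Submission
  imports Defs
begin

text \<open>On the overlap of the two words, reversing both sends position \<open>j\<close> to \<open>n - 1 - k - j\<close>, and
  this turns the comparison of \<open>u\<close> with \<open>v\<close> at shift \<open>k\<close> into that of \<open>v\<close> with \<open>u\<close> at shift
  \<open>m - n + k\<close>.\<close>

lemma length_correlation [simp]: "length (correlation u v) = length u"
  by (simp add: correlation_def)

text \<open>The equation \<open>i = j + k\<close> determines \<open>i\<close>, so one quantifier
  suffices and the bound on \<open>i\<close> turns into a premise on \<open>j\<close>.\<close>

lemma nth_correlation:
  assumes "k < length u"
  shows "correlation u v ! k =
    (if \<forall>j<length v. j + k < length u \<longrightarrow> u ! (j + k) = v ! j then 1 else 0)"
  using assms by (auto simp: correlation_def)

lemma palindrome_nth: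
  assumes "palindrome w" "i < length w"
  shows "w ! (length w - 1 - i) = w ! i"
  using assms rev_nth[of i w] by (simp add: palindrome_def)

lemma palindromes_overlap_iff:
  assumes "palindrome u" "palindrome v" "length u \<le> length v" "k < length u"
  shows "(\<forall>j<length u - k. u ! (j + k) = v ! j) \<longleftrightarrow>
    (\<forall>j<length u - k. v ! (j + (length v - length u + k)) = u ! j)"
proof -
  \<comment> \<open>Reversal of the overlap, which has length \<open>length u - k\<close>. As an
    involution of this range, \<open>r\<close> reindexes the quantifier in both directions.\<close>
  define r where "r j = length u - k - 1 - j" for j
  have r: "r j < length u - k" "r (r j) = j" if "j < length u - k" for j
    using that by (auto simp: r_def)
  have u: "u ! (r j + k) = u ! j"
    and v: "v ! (j + (length v - length u + k)) = v ! r j" if "j < length u - k" for j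
  proof -
    \<comment> \<open>The overlap is the suffix of \<open>u\<close> starting at \<open>k\<close>,
      hence the offset \<open>k\<close>.\<close>
    have "length u - 1 - j = r j + k"
      using that by (simp add: r_def)
    then show "u ! (r j + k) = u ! j"
      using palindrome_nth[OF assms(1), of j] that by simp
    \<comment> \<open>In \<open>v\<close> the overlap is a prefix; reflection carries it to the
      suffix of the same length, which starts at \<open>length v - length u + k\<close>.\<close>
    have "length v - 1 - r j = j + (length v - length u + k)" "r j < length v"
      using that assms(3) by (auto simp: r_def)
    then show "v ! (j + (length v - length u + k)) = v ! r j"
      using palindrome_nth[OF assms(2), of "r j"] by simp
  qed
  show ?thesis
    using r u v by metis
qed

lemma correlation_palindromes:
  assumes "palindrome u" "palindrome v" "length u \<le> length v" "k < length u"
  shows "correlation u v ! k = correlation v u ! (length v - length u + k)"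
proof -
  have "(\<forall>j<length v. j + k < length u \<longrightarrow> u ! (j + k) = v ! j) \<longleftrightarrow>
      (\<forall>j<length u - k. u ! (j + k) = v ! j)"
    using assms(3) by (auto simp: less_diff_conv)
  \<comment> \<open>After the swap, the end of \<open>v\<close> cuts off the overlap at the same
    length \<open>length u - k\<close>.\<close>
  moreover have "j + (length v - length u + k) < length v \<longleftrightarrow> j < length u - k" for j
    using assms(3,4) by linarith
  then have "(\<forall>j<length u. j + (length v - length u + k) < length v \<longrightarrow>
        v ! (j + (length v - length u + k)) = u ! j) \<longleftrightarrow>
      (\<forall>j<length u - k. v ! (j + (length v - length u + k)) = u ! j)"
    by auto
  moreover have "length v - length u + k < length v"
    using assms(3,4) by linarith
  ultimately show ?thesis
    using palindromes_overlap_iff[OF assms] assms(4) by (simp only: nth_correlation)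
qed

theorem theorem1:
  fixes A :: "'a set" and n m :: nat and u v :: "'a list"
  assumes "finite A"
    and "n \<le> m"
    and "u \<in> words A n"
    and "v \<in> words A m"
    and "palindrome u"
    and "palindrome v"
  shows "correlation u v = factor (correlation v u) (m - n) (m - 1)
    \<and> (\<forall>k\<in>{..<n}. correlation u v ! k = correlation v u ! (m - n + k))"
proof -
  have len: "length u = n" "length v = m"
    using assms(3,4) by (auto simp: words_def)
  have nth: "correlation u v ! k = correlation v u ! (m - n + k)" if "k < n" for k
    using correlation_palindromes[of u v k] assms(2,5,6) len that by simp
  moreover have "correlation u v = factor (correlation v u) (m - n) (m - 1)"
  proof (rule nth_equalityI)
    \<comment> \<open>For \<open>m = 0\<close> the value \<open>Suc (m - 1)\<close> is
      \<open>1\<close> instead of \<open>m\<close>, but \<open>take\<close> on the empty list still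
      yields length \<open>0 = n\<close>.\<close>
    show "length (correlation u v) = length (factor (correlation v u) (m - n) (m - 1))"
      using assms(2) len by (auto simp: factor_def)
    show "correlation u v ! k = factor (correlation v u) (m - n) (m - 1) ! k"
      if "k < length (correlation u v)" for k
      using that nth[of k] assms(2) len by (simp add: factor_def)
  qed
  ultimately show ?thesis
    by simp
qed

end
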